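(* Let $n\geq 2$ be a natural number, let $K$ be an algebraically closed field, let $G$ be a group, and let $K_\rho G$ be a twisted group algebra of $G$ over $K$ with factor system $\rho$. Then $K_\rho G$ is $n$-weakly regular if and only if the following conditions all hold: (i) $G$ is an abelian torsion group; (ii) the order of every element of $G$ is invertible in $K$; (iii) the factor system $\rho$ is symmetric.
   Context: Let $G$ be a group and $K$ a field. A twisted group algebra (twisted group ring) $K_\rho G$ of $G$ over $K$ is an associative $K$-algebra with a $K$-basis $\{u_g \mid g\in G\}$ indexed by $G$ (so scalars of $K$ commute with all $u_g$) and with multiplication determined by $u_g u_h=\rho(g,h)u_{gh}$ for $g,h\in G$, where $\rho=\{\rho(g,h)\mid g,h\in G\}$ is a family of nonzero elements of $K$ (the factor system) for which this multiplication is associative. The factor system is assumed normalized: $\rho(g,1)=\rho(1,g)=\rho(1,1)=1$ for all $g\in G$, so $u_1$ is the identity element. The factor system $\rho$ is called symmetric if for all $g,h\in G$ the condition $gh=hg$ implies $\rho(g,h)=\rho(h,g)$. For a fixed natural number $n\geq 2$, a ring $R$ is called $n$-weakly regular if for every $a\in R$ there exist $b,c\in R$ such that $a=aba^nc$. A condition that the order of an element is invertible in $K$ means that this integer is nonzero in $K$. *)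

theory Defs
  imports
    "HOL-Algebra.Multiplicative_Group"
    "HOL-Computational_Algebra.Polynomial"
begin

text \<open>
  The whole type \<open>'a\<close> is the algebra; associativity of the factor system is not a separate
  assumption, since it is associativity of the multiplication of \<open>'a\<close>. The constant
  \<open>1 :: 'a\<close> is not assumed to be \<open>u \<one>\<close>: see \<open>u_one\<close> below.
\<close>

locale twisted_group_algebra = group G + vector_space scale
  for G :: "('g, 'm) monoid_scheme" (structure)
    and scale :: "'k::field \<Rightarrow> 'a::ring_1 \<Rightarrow> 'a" (infixr \<open>*s\<close> 75) +
  fixes \<rho> :: "'g \<Rightarrow> 'g \<Rightarrow> 'k"
    and u :: "'g \<Rightarrow> 'a"
  assumes scale_mult_left: "(c *s x) * y = c *s (x * y)"
    and scale_mult_right: "x * (c *s y) = c *s (x * y)"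
    and inj_on_u: "inj_on u (carrier G)"
    and independent_u: "independent (u ` carrier G)"
    and span_u: "span (u ` carrier G) = UNIV"
    and u_mult: "\<lbrakk>g \<in> carrier G; h \<in> carrier G\<rbrakk> \<Longrightarrow> u g * u h = \<rho> g h *s u (g \<otimes> h)"
    and factor_nonzero: "\<lbrakk>g \<in> carrier G; h \<in> carrier G\<rbrakk> \<Longrightarrow> \<rho> g h \<noteq> 0"
    and factor_one_right: "g \<in> carrier G \<Longrightarrow> \<rho> g \<one> = 1"
    and factor_one_left: "g \<in> carrier G \<Longrightarrow> \<rho> \<one> g = 1"
begin

lemma u_one: "u \<one> = 1"
proof -
  have "u \<one> * x = x" for x
  proof -
    have "x \<in> span (u ` carrier G)"
      by (simp add: span_u)
    then show ?thesis
    proof (induction rule: span_induct_alt)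
      case base
      show ?case by simp
    next
      case (step c x y)
      then obtain g where g: "g \<in> carrier G" "x = u g"
        by blast
      then have "u \<one> * x = x"
        by (simp add: u_mult factor_one_left)
      with step show ?case
        by (simp add: distrib_left scale_mult_right)
    qed
  qed
  from this[of 1] show ?thesis by simp
qed

end

definition symmetric_factor_system ::
    "('g, 'm) monoid_scheme \<Rightarrow> ('g \<Rightarrow> 'g \<Rightarrow> 'k) \<Rightarrow> bool" where
  "symmetric_factor_system G \<rho> \<longleftrightarrow>
     (\<forall>g\<in>carrier G. \<forall>h\<in>carrier G. g \<otimes>\<^bsub>G\<^esub> h = h \<otimes>\<^bsub>G\<^esub> g \<longrightarrow> \<rho> g h = \<rho> h g)"

definition torsion_group :: "('g, 'm) monoid_scheme \<Rightarrow> bool" where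
  "torsion_group G \<longleftrightarrow>
     group G \<and> (\<forall>g\<in>carrier G. \<exists>m::nat. m > 0 \<and> g [^]\<^bsub>G\<^esub> m = \<one>\<^bsub>G\<^esub>)"

definition n_weakly_regular :: "nat \<Rightarrow> 'a::ring_1 itself \<Rightarrow> bool" where
  "n_weakly_regular n R \<longleftrightarrow> (\<forall>a::'a. \<exists>b c. a = a * b * a ^ n * c)"

end

theory Submission
  imports Defs
begin

text \<open>
  For \<open>n \<ge> 2\<close>, an \<open>n\<close>-weakly regular ring has no nonzero element of square zero, so its idempotents
  are central. This makes the \<open>n\<close>-weakly regular rings the same as the strongly regular ones, where
  every \<open>a\<close> is a left multiple of \<open>a\<^sup>2\<close>
  (\<open>n_weakly_regular_imp_strongly_regular\<close>, \<open>strongly_regular_imp_n_weakly_regular\<close>). It remains to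
  decide when a twisted group algebra is strongly regular.

  The two implications meet in the subspace spanned by the idempotents. If \<open>g\<close> has an order \<open>m\<close> that
  is invertible in the algebraically closed field, then \<open>(u g)\<^sup>m\<close> is a nonzero scalar, so \<open>u g\<close> is a
  root of a separable polynomial \<open>X\<^sup>m - c\<close> that splits, and by Lagrange interpolation \<open>u g\<close> is a linear
  combination of idempotents (\<open>u_in_span_idempotents\<close>).

  Suppose that the algebra is strongly regular. Comparing finite supports, \<open>1 - u g = s (1 - u g)\<^sup>2\<close>
  is impossible for \<open>g\<close> of infinite order (\<open>strongly_regular_imp_ord_pos\<close>). If the order \<open>m\<close> of \<open>g\<close>
  were zero in the field, the sum of the powers of a suitable multiple of \<open>u g\<close> would be a nonzero
  element of square zero (\<open>reduced_imp_ord_invertible\<close>). Hence each \<open>u g\<close> is a combination of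
  idempotents, which are central; so all \<open>u g\<close> commute, and this says that the group is abelian and the
  factor system symmetric (\<open>commute_u_iff\<close>).

  Conversely, under the three conditions the algebra is commutative and spanned by idempotents. A finite
  combination of central idempotents is strongly regular because it is a scalar on each factor of the
  corresponding decomposition of the ring (\<open>span_central_idempotents_regular\<close>).
\<close>

section \<open>Strongly regular rings\<close>

definition reduced_ring :: "'a::ring_1 itself \<Rightarrow> bool" where
  "reduced_ring R \<longleftrightarrow> (\<forall>a::'a. a * a = 0 \<longrightarrow> a = 0)"

definition strongly_regular_ring :: "'a::ring_1 itself \<Rightarrow> bool" where
  "strongly_regular_ring R \<longleftrightarrow> (\<forall>a::'a. \<exists>t. a = t * a * a)"

lemma reduced_ringD: "reduced_ring TYPE('a::ring_1) \<Longrightarrow> (a::'a) * a = 0 \<Longrightarrow> a = 0"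
  unfolding reduced_ring_def by blast

text \<open>
  Since \<open>(y x)\<^sup>2 = y (x y) x = 0\<close>, zero products commute in a reduced ring; then \<open>x r y\<close>
  also squares to zero.
\<close>

lemma reduced_ring_mult_eq_0_insert:
  fixes x y :: "'a::ring_1"
  assumes "reduced_ring TYPE('a)" "x * y = 0"
  shows "x * r * y = 0"
proof -
  have yx: "y * x = 0"
  proof (rule reduced_ringD[OF assms(1)])
    have "(y * x) * (y * x) = y * (x * y) * x"
      by (simp add: mult.assoc)
    then show "(y * x) * (y * x) = 0"
      by (simp add: assms(2))
  qed
  show ?thesis
  proof (rule reduced_ringD[OF assms(1)])
    have "(x * r * y) * (x * r * y) = x * r * (y * x) * r * y"
      by (simp add: mult.assoc)
    then show "(x * r * y) * (x * r * y) = 0"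
      by (simp add: yx)
  qed
qed

text \<open>
  Insert \<open>r\<close> into the zero products \<open>e (1 - e)\<close> and \<open>(1 - e) e\<close>: both \<open>e r\<close> and \<open>r e\<close> are
  equal to \<open>e r e\<close>.
\<close>

lemma reduced_ring_idempotent_central:
  fixes e :: "'a::ring_1"
  assumes "reduced_ring TYPE('a)" "e * e = e"
  shows "e * r = r * e"
proof -
  have "e * (1 - e) = 0" "(1 - e) * e = 0"
    using assms(2) by (simp_all add: algebra_simps)
  then have "e * r * (1 - e) = 0" "(1 - e) * r * e = 0"
    using assms(1) reduced_ring_mult_eq_0_insert by blast+
  then have "e * r = e * r * e" "r * e = e * r * e"
    by (simp_all only: left_diff_distrib right_diff_distrib mult_1_left mult_1_right
        right_minus_eq)
  then show ?thesis
    by metis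
qed

lemma strongly_regular_imp_reduced:
  "strongly_regular_ring TYPE('a::ring_1) \<Longrightarrow> reduced_ring TYPE('a)"
  unfolding strongly_regular_ring_def reduced_ring_def
proof (intro allI impI)
  fix a :: 'a
  assume *: "\<forall>a::'a. \<exists>t. a = t * a * a" "a * a = 0"
  then obtain t where "a = t * a * a"
    by blast
  then show "a = 0"
    by (simp add: mult.assoc *(2))
qed

lemma n_weakly_regular_imp_reduced:
  assumes "n_weakly_regular n TYPE('a::ring_1)" "n \<ge> 2"
  shows "reduced_ring TYPE('a)"
  unfolding reduced_ring_def
proof (intro allI impI)
  fix a :: 'a
  assume "a * a = 0"
  moreover have "a ^ n = a * a * a ^ (n - 2)"
    using assms(2) by (metis le_add_diff_inverse power2_eq_square power_add)
  ultimately have "a ^ n = 0"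
    by simp
  then show "a = 0"
    using assms(1) unfolding n_weakly_regular_def by (metis mult_zero_left mult_zero_right)
qed

text \<open>
  Write \<open>a = a e\<close> with \<open>e = b a\<^sup>n c\<close>. As \<open>a (1 - e) = 0\<close> and zero products absorb arbitrary
  middle factors, \<open>e\<close> is an idempotent, hence central. In the corner \<open>e R\<close> the element \<open>c\<close>
  has the left inverse \<open>b a\<^sup>n\<close>; one-sided inverses in a reduced ring are two-sided because the
  idempotent \<open>f\<close> formed by the opposite product is central too. So \<open>e = c e b a\<^sup>n\<close>, and
  \<open>a = e a\<close> becomes a left multiple of \<open>a\<^sup>2\<close>.
\<close>

lemma n_weakly_regular_imp_strongly_regular:
  assumes "n_weakly_regular n TYPE('a::ring_1)" "n \<ge> 2"
  shows "strongly_regular_ring TYPE('a)"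
  unfolding strongly_regular_ring_def
proof
  fix a :: 'a
  note red = n_weakly_regular_imp_reduced[OF assms]
  obtain b c where abc: "a = a * b * a ^ n * c"
    using assms(1) unfolding n_weakly_regular_def by blast
  define e where "e = b * a ^ n * c"
  have ae: "a * e = a"
    using abc by (simp add: e_def mult.assoc)
  have "a * (1 - e) = 0"
    by (simp add: ae algebra_simps)
  have an: "a ^ n = a ^ (n - 1) * a"
    using assms(2) by (cases n) (simp_all del: power_Suc add: power_Suc2)
  have "e * (1 - e) = b * a ^ (n - 1) * (a * c * (1 - e))"
    by (simp add: e_def an mult.assoc)
  also have "\<dots> = 0"
    using reduced_ring_mult_eq_0_insert[OF red \<open>a * (1 - e) = 0\<close>] by simp
  finally have ee: "e * e = e"
    by (simp add: algebra_simps)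
  note e_central = reduced_ring_idempotent_central[OF red ee]
  define f where "f = c * e * b * a ^ n"
  have "f * f = c * (e * (b * a ^ n * c) * e) * b * a ^ n"
    by (simp add: f_def mult.assoc)
  also have "\<dots> = f"
    by (simp add: e_def[symmetric] ee f_def)
  finally have ff: "f * f = f" .
  note f_central = reduced_ring_idempotent_central[OF red ff]
  have "f * e = c * (e * e) * b * a ^ n"
    using e_central[of f] e_central[of c] by (simp add: f_def flip: mult.assoc)
  then have fe: "f * e = f"
    by (simp add: ee f_def)
  have "b * a ^ n * f * c = (b * a ^ n * c) * e * (b * a ^ n * c)"
    by (simp add: f_def mult.assoc)
  also have "\<dots> = e"
    by (simp add: e_def[symmetric] ee)
  finally have "e = f * (b * a ^ n) * c"
    by (simp only: f_central)
  then have "e = f"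
    by (simp only: mult.assoc[of f] e_def[symmetric] fe)
  then have "a = f * a"
    using ae e_central by metis
  moreover have "f * a = (c * e * b * a ^ (n - 1)) * a * a"
    by (simp add: f_def an mult.assoc)
  ultimately show "\<exists>t. a = t * a * a"
    by metis
qed

text \<open>
  Iterating \<open>a = t a\<^sup>2\<close> gives \<open>a = t\<^sup>k a\<^bsup>k+1\<^esup>\<close>. The missing left factor \<open>a\<close> comes from
  \<open>a = a t a\<close>: the difference \<open>d\<close> of the two sides satisfies \<open>d a = 0\<close>, hence \<open>d\<^sup>2 = 0\<close>.
\<close>

lemma strongly_regular_imp_n_weakly_regular:
  assumes sr: "strongly_regular_ring TYPE('a::ring_1)" and "n \<ge> 1"
  shows "n_weakly_regular n TYPE('a)"
  unfolding n_weakly_regular_def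
proof
  fix a :: 'a
  obtain t where t: "a = t * a * a"
    using sr unfolding strongly_regular_ring_def by blast
  have "a = t ^ k * a ^ Suc k" for k
  proof (induction k)
    case (Suc k)
    have "t ^ Suc k * a ^ Suc (Suc k) = t ^ k * (t * a * a) * a ^ k"
      unfolding power_Suc2[of t] power_Suc[of a] by (simp add: mult.assoc)
    also have "\<dots> = t ^ k * a ^ Suc k"
      unfolding t[symmetric] by (simp add: mult.assoc)
    finally show ?case
      using Suc by simp
  qed simp
  from this[of "n - 1"] have an: "a = t ^ (n - 1) * a ^ n"
    using \<open>n \<ge> 1\<close> by simp
  define d where "d = a - a * t * a"
  have "a * t * a * a = a * (t * a * a)"
    by (simp only: mult.assoc)
  then have da: "d * a = 0"
    by (simp add: d_def left_diff_distrib t[symmetric])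
  have "d = 0"
  proof (rule reduced_ringD[OF strongly_regular_imp_reduced[OF sr]])
    have "d * d = d * a - d * a * t * a"
      by (simp add: d_def right_diff_distrib mult.assoc)
    then show "d * d = 0"
      by (simp add: da)
  qed
  then have "a = a * t * a"
    unfolding d_def by (rule eq_iff_diff_eq_0[THEN iffD2])
  also have "a * t * a = a * t * (t ^ (n - 1) * a ^ n)"
    using an by (rule arg_cong)
  also have "\<dots> = a * (t * t ^ (n - 1)) * a ^ n * 1"
    by (simp only: mult.assoc mult_1_right)
  finally show "\<exists>b c. a = a * b * a ^ n * c"
    by (intro exI)
qed

section \<open>Idempotents and separable polynomials\<close>

lemma pderiv_prod_mset_linear:
  "pderiv (\<Prod>x\<in>#A. [:- x, 1:]) = (\<Sum>x\<in>#A. \<Prod>y\<in>#A - {#x#}. [:- y, 1:])"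
  for A :: "'b::idom multiset"
proof (induction A)
  case (add a A)
  have "(\<Prod>y\<in>#add_mset a A - {#x#}. [:- y, 1:]) = [:- a, 1:] * (\<Prod>y\<in>#A - {#x#}. [:- y, 1:])"
    if "x \<in># A" for x
    using that by (simp add: multiset_diff_union_assoc del: mult_pCons_left)
  then have "(\<Sum>x\<in>#A. \<Prod>y\<in>#add_mset a A - {#x#}. [:- y, 1:]) =
      (\<Sum>x\<in>#A. [:- a, 1:] * (\<Prod>y\<in>#A - {#x#}. [:- y, 1:]))"
    by (intro arg_cong[of _ _ sum_mset] image_mset_cong)
  then show ?case
    by (simp add: pderiv_mult add.IH pderiv_pCons sum_mset_distrib_left del: mult_pCons_left)
qed simp

locale unital_algebra = vector_space scale
  for scale :: "'k::field \<Rightarrow> 'a::ring_1 \<Rightarrow> 'a" (infixr \<open>*s\<close> 75) +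
  assumes scale_mult_left: "(c *s x) * y = c *s (x * y)"
    and scale_mult_right: "x * (c *s y) = c *s (x * y)"
begin

text \<open>
  In contrast to \<open>poly\<close>, the point of evaluation lies in a possibly noncommutative algebra over the
  coefficient field.
\<close>

definition eval_at :: "'a \<Rightarrow> 'k poly \<Rightarrow> 'a" where
  "eval_at x p = fold_coeffs (\<lambda>c y. c *s 1 + x * y) p 0"

lemma eval_at_0 [simp]: "eval_at x 0 = 0"
  by (simp add: eval_at_def)

lemma eval_at_pCons [simp]: "eval_at x (pCons c p) = c *s 1 + x * eval_at x p"
  by (cases "p = 0 \<and> c = 0") (auto simp: eval_at_def)

lemma eval_at_1 [simp]: "eval_at x 1 = 1"
  by (simp add: one_pCons)

lemma eval_at_add: "eval_at x (p + q) = eval_at x p + eval_at x q"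
  by (induction p q rule: poly_induct2) (simp_all add: algebra_simps)

lemma eval_at_smult: "eval_at x (smult c p) = c *s eval_at x p"
  by (induction p) (simp_all add: algebra_simps scale_mult_right)

lemma eval_at_mult: "eval_at x (p * q) = eval_at x p * eval_at x q"
  by (induction p) (simp_all add: eval_at_add eval_at_smult scale_mult_left algebra_simps)

lemma eval_at_monom: "eval_at x (monom c n) = c *s x ^ n"
  by (induction n) (simp_all add: monom_0 monom_Suc scale_mult_right)

lemma eval_at_eigenvector:
  assumes "x * w = z *s w"
  shows "eval_at x p * w = poly p z *s w"
proof (induction p)
  case (pCons c p)
  have "eval_at x (pCons c p) * w = c *s w + x * (eval_at x p * w)"
    by (simp add: distrib_right scale_mult_left mult.assoc)
  also have "\<dots> = c *s w + poly p z *s (x * w)"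
    by (simp add: pCons.IH scale_mult_right)
  finally show ?case
    using assms by (simp add: algebra_simps)
qed simp

lemma span_sum_mset:
  assumes "\<And>z. z \<in># B \<Longrightarrow> f z \<in> span S"
  shows "(\<Sum>z\<in>#B. f z) \<in> span S"
  using assms
proof (induction B)
  case empty
  show ?case
    by (simp add: span_zero)
next
  case (add z B)
  then show ?case
    by (simp add: span_add)
qed

text \<open>
  Lagrange interpolation. For a linear factor \<open>p = (X - z) q\<^sub>z\<close>, the element \<open>w = q\<^sub>z(v)\<close> is an
  eigenvector of \<open>v\<close> with eigenvalue \<open>z\<close>, so \<open>w\<^sup>2 = q\<^sub>z(z) w\<close> and \<open>w\<close> is a multiple of an
  idempotent as soon as \<open>q\<^sub>z(z) = p'(z)\<close> is nonzero, which the Bezout identity for \<open>p\<close> and \<open>p'\<close>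
  ensures. Evaluating the same identity at \<open>v\<close> gives \<open>s(v) p'(v) = 1\<close>; since
  \<open>p' = \<Sum>\<^sub>z q\<^sub>z\<close>, the element \<open>v = v s(v) p'(v)\<close> is a combination of such eigenvectors.
\<close>

lemma separable_root_in_span_idempotents:
  assumes root: "eval_at v p = 0"
    and split: "p = (\<Prod>x\<in>#A. [:- x, 1:])"
    and separable: "r * p + s * pderiv p = 1"
  shows "v \<in> span {e. e * e = e}"
proof -
  let ?q = "\<lambda>z. \<Prod>y\<in>#A - {#z#}. [:- y, 1:]"
  have summand: "v * eval_at v s * eval_at v (?q z) \<in> span {e. e * e = e}" if "z \<in># A" for z
  proof -
    let ?w = "eval_at v (?q z)"
    have p_eq: "p = [:- z, 1:] * ?q z"
      unfolding split using that by (metis (no_types, lifting) insert_DiffM image_mset_add_mset prod_mset.add_mset)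
    have "(v - z *s 1) * ?w = eval_at v p"
      by (subst p_eq, subst eval_at_mult) simp
    then have eigen: "v * ?w = z *s ?w"
      using root by (simp add: left_diff_distrib scale_mult_left)
    have pz: "poly p z = 0"
      by (subst p_eq) simp
    have "poly (pderiv p) z = poly (?q z) z"
      by (subst p_eq, subst pderiv_mult) (simp add: pderiv_pCons)
    moreover have "poly s z * poly (pderiv p) z = 1"
      using arg_cong[OF separable, of "\<lambda>f. poly f z"] pz by simp
    ultimately have qz: "poly (?q z) z \<noteq> 0"
      by auto
    define e where "e = inverse (poly (?q z) z) *s ?w"
    have "?w * ?w = poly (?q z) z *s ?w"
      by (rule eval_at_eigenvector[OF eigen])
    then have "e * e = e"
      using qz by (simp add: e_def scale_mult_left scale_mult_right)
    moreover have "?w = poly (?q z) z *s e"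
      using qz by (simp add: e_def)
    moreover have "v * eval_at v s * ?w = (z * poly s z) *s ?w"
      by (simp add: mult.assoc eval_at_eigenvector[OF eigen] scale_mult_right eigen mult.commute)
    ultimately show ?thesis
      by (metis (mono_tags, lifting) mem_Collect_eq span_base span_scale)
  qed
  have "v = v * eval_at v (r * p + s * pderiv p)"
    by (simp add: separable)
  also have "\<dots> = v * eval_at v s * eval_at v (pderiv p)"
    by (simp add: eval_at_add eval_at_mult root mult.assoc)
  also have "\<dots> = (\<Sum>z\<in>#A. v * eval_at v s * eval_at v (?q z))"
    unfolding split pderiv_prod_mset_linear
  proof -
    have "x * eval_at v (\<Sum>z\<in>#B. f z) = (\<Sum>z\<in>#B. x * eval_at v (f z))" for x B and f :: "'k \<Rightarrow> 'k poly"
      by (induction B) (simp_all add: eval_at_add distrib_left)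
    then show "v * eval_at v s * eval_at v (\<Sum>z\<in>#A. ?q z) = (\<Sum>z\<in>#A. v * eval_at v s * eval_at v (?q z))" .
  qed
  also have "\<dots> \<in> span {e. e * e = e}"
    by (rule span_sum_mset) (rule summand)
  finally show ?thesis .
qed

text \<open>
  The claim is strengthened to all shifts \<open>y + c\<close> by scalars in order to be inductive: adding
  \<open>d e\<close> to \<open>y\<close> shifts \<open>y + c\<close> by the scalar \<open>d\<close> on the factor \<open>e R\<close> of the ring and leaves it
  unchanged on the complementary factor \<open>(1 - e) R\<close>, so the two multipliers can be glued.
\<close>

lemma span_central_idempotents_regular:
  assumes "y \<in> span {e. e * e = e \<and> (\<forall>x. e * x = x * e)}"
  shows "\<exists>t. y = t * y * y"
proof -
  have "\<exists>t. y + c *s 1 = t * (y + c *s 1) * (y + c *s 1)" for c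
    using assms
  proof (induction arbitrary: c rule: span_induct_alt)
    case base
    have "c *s 1 = (inverse c *s 1) * (c *s 1) * (c *s 1)"
      by (cases "c = 0") (simp_all add: scale_mult_left)
    then show ?case by auto
  next
    case (step d e y)
    from \<open>e \<in> _\<close> have ee: "e * e = e" and e_central: "\<And>x. e * x = x * e"
      by blast+
    define f where "f = 1 - e"
    have ff: "f * f = f" and ef: "e * f = 0" and fe: "f * e = 0"
      by (simp_all add: f_def algebra_simps ee)
    have f_central: "f * x = x * f" for x
      by (simp add: f_def left_diff_distrib right_diff_distrib e_central[of x])
    obtain t1 where t1: "y + (c + d) *s 1 = t1 * (y + (c + d) *s 1) * (y + (c + d) *s 1)"
      using step.IH by blast
    obtain t2 where t2: "y + c *s 1 = t2 * (y + c *s 1) * (y + c *s 1)"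
      using step.IH by blast
    let ?a = "y + (c + d) *s 1" and ?b = "y + c *s 1"
    have prod: "(e * x + f * z) * (e * x' + f * z') = e * (x * x') + f * (z * z')" for x x' z z'
    proof -
      have "(e * x) * (e * x') = e * (x * x')" "(f * z) * (f * z') = f * (z * z')"
        "(e * x) * (f * z') = 0" "(f * z) * (e * x') = 0"
        by (metis ee e_central mult.assoc) (metis ff f_central mult.assoc,
          metis ef e_central mult.assoc mult_zero_left mult_zero_right,
          metis fe f_central mult.assoc mult_zero_left mult_zero_right)
      then show ?thesis
        by (simp add: distrib_left distrib_right)
    qed
    have "d *s e + y + c *s 1 = e * ?a + f * ?b"
      by (simp add: f_def algebra_simps scale_mult_right)
    moreover have "e * ?a + f * ?b = (e * t1 + f * t2) * (e * ?a + f * ?b) * (e * ?a + f * ?b)"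
      using t1 t2 by (simp only: prod)
    ultimately show ?case
      by metis
  qed
  from this[of 0] show ?thesis
    by simp
qed

lemma commute_with_span:
  assumes "y \<in> span S" "\<And>e. e \<in> S \<Longrightarrow> e * x = x * e"
  shows "y * x = x * y"
  using assms(1)
  by (induction rule: span_induct_alt) (auto simp: algebra_simps scale_mult_left scale_mult_right assms(2))

end

text \<open>
  The polynomial \<open>X\<^sup>m - c\<close> splits over an algebraically closed field, and it is separable because
  \<open>X p' - m p = m c\<close> is a nonzero constant.
\<close>

lemma root_of_scalar_in_span_idempotents:
  fixes scale :: "'k::alg_closed_field \<Rightarrow> 'a::ring_1 \<Rightarrow> 'a"
  assumes alg: "unital_algebra scale"
    and v: "v ^ m = scale c 1"
    and c: "c \<noteq> 0" and m: "of_nat m \<noteq> (0::'k)"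
  shows "v \<in> module.span scale {e. e * e = e}"
proof -
  interpret unital_algebra scale by (fact alg)
  define p where "p = monom 1 m - [:c:]"
  have "m > 0"
    using m by (cases m) auto
  have deg: "degree p = m"
    unfolding p_def using \<open>m > 0\<close> by (subst diff_conv_add_uminus, subst degree_add_eq_left) (auto simp: degree_monom_eq)
  then have lead: "lead_coeff p = 1"
    using \<open>m > 0\<close> by (simp add: p_def coeff_pCons split: nat.split)
  then obtain A where A: "p = (\<Prod>x\<in>#A. [:- x, 1:])"
    using alg_closed_imp_factorization[of p] by (metis leading_coeff_0_iff smult_1_left zero_neq_one)
  have "eval_at v p + scale c 1 = eval_at v (p + [:c:])"
    by (simp add: eval_at_add)
  also have "\<dots> = scale c 1"
    by (simp add: p_def eval_at_monom v)
  finally have root: "eval_at v p = 0"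
    by simp
  \<comment> \<open>the Bezout identity \<open>(X p' - m p) / (m c) = 1\<close>\<close>
  have "monom (inverse (of_nat m * c)) 1 * pderiv p = monom (inverse c) m"
    using m \<open>m > 0\<close> by (simp add: p_def pderiv_diff pderiv_monom mult_monom)
  then have "[:- inverse c:] * p + monom (inverse (of_nat m * c)) 1 * pderiv p = 1"
    using c \<open>m > 0\<close> by (intro poly_eqI) (simp add: p_def coeff_pCons one_pCons split: nat.split)
  then show ?thesis
    by (rule separable_root_in_span_idempotents[OF root A])
qed

section \<open>Supports in a twisted group algebra\<close>

lemma one_minus_times_geometric_sum: "(1 - x) * (\<Sum>i<k. x ^ i) = 1 - x ^ k"
  for x :: "'b::ring_1"
proof (induction k)
  case (Suc k)
  have "(1 - x) * (\<Sum>i<Suc k. x ^ i) = (1 - x) * (\<Sum>i<k. x ^ i) + (1 - x) * x ^ k"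
    by (simp add: distrib_left)
  then show ?case
    unfolding Suc.IH by (simp add: left_diff_distrib)
qed simp

sublocale twisted_group_algebra \<subseteq> unital_algebra scale
  by unfold_locales (fact scale_mult_left scale_mult_right)+

context twisted_group_algebra
begin

definition coeff_u :: "'a \<Rightarrow> 'g \<Rightarrow> 'k" where
  "coeff_u x g = representation (u ` carrier G) x (u g)"

definition support :: "'a \<Rightarrow> 'g set" where
  "support x = {g \<in> carrier G. coeff_u x g \<noteq> 0}"

lemma in_span_u: "x \<in> span (u ` carrier G)"
  by (simp add: span_u)

lemma coeff_u_0 [simp]: "coeff_u 0 g = 0"
  by (simp add: coeff_u_def representation_zero)

lemma coeff_u_add: "coeff_u (x + y) g = coeff_u x g + coeff_u y g"
  by (simp add: coeff_u_def representation_add independent_u in_span_u)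

lemma coeff_u_diff: "coeff_u (x - y) g = coeff_u x g - coeff_u y g"
  by (simp add: coeff_u_def representation_diff independent_u in_span_u)

lemma coeff_u_scale: "coeff_u (c *s x) g = c * coeff_u x g"
  by (simp add: coeff_u_def representation_scale independent_u in_span_u)

lemma coeff_u_sum: "coeff_u (sum f I) g = (\<Sum>i\<in>I. coeff_u (f i) g)"
  by (induction I rule: infinite_finite_induct) (simp_all add: coeff_u_add)

lemma coeff_u_u:
  "\<lbrakk>g \<in> carrier G; h \<in> carrier G\<rbrakk> \<Longrightarrow> coeff_u (u g) h = (if g = h then 1 else 0)"
  using inj_on_u by (auto simp: coeff_u_def representation_basis independent_u inj_on_eq_iff)

lemma coeff_u_mult_u:
  assumes "g \<in> carrier G" "h \<in> carrier G"
  shows "coeff_u (x * u h) (g \<otimes> h) = \<rho> g h * coeff_u x g"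
  using in_span_u[of x]
proof (induction rule: span_induct_alt)
  case (step c b y)
  then obtain k where "k \<in> carrier G" "b = u k"
    by blast
  then show ?case
    using assms step.IH
    by (auto simp: distrib_right scale_mult_left coeff_u_add coeff_u_scale u_mult coeff_u_u algebra_simps)
qed simp

lemma finite_support: "finite (support x)"
proof -
  have "finite {b. representation (u ` carrier G) x b \<noteq> 0}"
    by (rule finite_representation)
  moreover have "u ` support x \<subseteq> {b. representation (u ` carrier G) x b \<noteq> 0}"
    by (auto simp: support_def coeff_u_def)
  ultimately have "finite (u ` support x)"
    by (rule rev_finite_subset)
  moreover have "inj_on u (support x)"
    using inj_on_u by (rule inj_on_subset) (auto simp: support_def)
  ultimately show ?thesis
    by (rule finite_imageD)
qed

lemma support_0 [simp]: "support 0 = {}"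
  by (simp add: support_def)

lemma support_eq_empty_imp_eq_0:
  assumes "support x = {}"
  shows "x = 0"
proof -
  have "representation (u ` carrier G) x b = 0" for b
  proof (cases "b \<in> u ` carrier G")
    case True
    then show ?thesis
      using assms by (auto simp: support_def coeff_u_def)
  next
    case False
    then show ?thesis
      using representation_ne_zero by blast
  qed
  then show ?thesis
    using sum_nonzero_representation_eq[OF independent_u in_span_u[of x]] by simp
qed

lemma support_diff_subset: "support (x - y) \<subseteq> support x \<union> support y"
  by (auto simp: support_def coeff_u_diff)

lemma support_scale: "c \<noteq> 0 \<Longrightarrow> support (c *s x) = support x"
  by (auto simp: support_def coeff_u_scale)

lemma support_mult_u:
  assumes "h \<in> carrier G"
  shows "support (x * u h) = (\<lambda>g. g \<otimes> h) ` support x"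
proof (intro equalityI subsetI)
  fix k
  assume k: "k \<in> support (x * u h)"
  then have "k \<otimes> inv h \<in> support x"
    using assms coeff_u_mult_u[of "k \<otimes> inv h" h x] by (simp add: support_def m_assoc)
  moreover have "k = k \<otimes> inv h \<otimes> h"
    using k assms by (simp add: support_def m_assoc)
  ultimately show "k \<in> (\<lambda>g. g \<otimes> h) ` support x"
    by blast
qed (use assms in \<open>auto simp: support_def coeff_u_mult_u factor_nonzero\<close>)

text \<open>
  The scaling \<open>c\<close> is what allows a multiple of \<open>u g\<close> to be normalised to a root of \<open>1\<close>.
\<close>

lemma power_scaled_u:
  assumes "g \<in> carrier G" "c \<noteq> 0"
  obtains d where "d \<noteq> 0" "(c *s u g) ^ k = d *s u (g [^] (k::nat))"
proof -
  have "\<exists>d. d \<noteq> 0 \<and> (c *s u g) ^ k = d *s u (g [^] k)"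
  proof (induction k)
    case 0
    show ?case
      by (intro exI[of _ 1]) (simp add: u_one)
  next
    case (Suc k)
    then obtain d where "d \<noteq> 0" "(c *s u g) ^ k = d *s u (g [^] k)"
      by blast
    then show ?case
      using assms
      by (intro exI[of _ "c * d * \<rho> (g [^] k) g"])
        (simp add: power_Suc2 scale_mult_left scale_mult_right u_mult factor_nonzero mult_ac del: power_Suc)
  qed
  then show thesis
    using that by blast
qed

lemma support_mult_power_u:
  assumes "g \<in> carrier G"
  shows "support (x * u g ^ k) = (\<lambda>s. s \<otimes> g [^] k) ` support x"
proof -
  obtain d where "d \<noteq> 0" "(1 *s u g) ^ k = d *s u (g [^] k)"
    using power_scaled_u[OF assms, of 1] by auto
  then show ?thesis
    using assms by (simp add: scale_mult_right support_scale support_mult_u)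
qed

text \<open>
  As distinct powers of \<open>g\<close> give distinct basis vectors, no cancellation can occur. This is used both
  for an element of infinite order and for the powers below the order of a torsion element.
\<close>

lemma support_geometric_sum:
  fixes k :: nat
  assumes g: "g \<in> carrier G" and "c \<noteq> 0" and inj: "inj_on (\<lambda>i::nat. g [^] i) {..<k}"
  shows "support (\<Sum>i<k. (c *s u g) ^ i) = (\<lambda>i. g [^] i) ` {..<k}"
proof -
  have "\<exists>d. d \<noteq> 0 \<and> (c *s u g) ^ i = d *s u (g [^] i)" for i
    using power_scaled_u[OF g \<open>c \<noteq> 0\<close>] by metis
  then obtain d where d: "\<And>i. d i \<noteq> 0" "\<And>i. (c *s u g) ^ i = d i *s u (g [^] i)"
    by metis
  have coeff: "coeff_u (\<Sum>i<k. (c *s u g) ^ i) h = (\<Sum>i<k. if g [^] i = h then d i else 0)"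
    if "h \<in> carrier G" for h
    using that g by (auto simp: coeff_u_sum d(2) coeff_u_scale coeff_u_u intro!: sum.cong)
  have "coeff_u (\<Sum>i<k. (c *s u g) ^ i) (g [^] j) = d j" if "j < k" for j
  proof -
    have "coeff_u (\<Sum>i<k. (c *s u g) ^ i) (g [^] j) = (\<Sum>i<k. if i = j then d i else 0)"
      using g that inj by (subst coeff) (auto simp: inj_on_eq_iff intro!: sum.cong)
    then show ?thesis
      using that by simp
  qed
  moreover have "coeff_u (\<Sum>i<k. (c *s u g) ^ i) h = 0"
    if "h \<in> carrier G" "h \<notin> (\<lambda>i. g [^] i) ` {..<k}" for h
    using that by (subst coeff) (auto intro!: sum.neutral)
  ultimately show ?thesis
    using g d(1) by (auto simp: support_def)
qed

section \<open>Consequences of regularity for the group and the factor system\<close>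

lemma ord_eq_0_imp_inj_pow:
  assumes "g \<in> carrier G" "ord g = 0"
  shows "inj (\<lambda>i::nat. g [^] i)"
proof (rule injI)
  fix i j :: nat
  assume "g [^] i = g [^] j"
  then show "i = j"
    using int_pow_eq[OF assms(1), of "int i" "int j"] assms(2) by (simp add: int_pow_int)
qed

text \<open>
  If \<open>g\<close> had infinite order, consider \<open>1 - u g = s (1 - u g)\<^sup>2\<close>. The element
  \<open>w = 1 - s (1 - u g)\<close> satisfies \<open>w = w u g\<close>, so its finite support is stable under right
  translation by \<open>g\<close> and must be empty; thus \<open>s (1 - u g) = 1\<close>. Multiplying by a geometric sum,
  \<open>\<Sum>i<k. (u g)\<^sup>i = s - s (u g)\<^sup>k\<close>: the left side has \<open>k\<close> basis vectors in its support, the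
  right side at most twice as many as \<open>s\<close>, for every \<open>k\<close>.
\<close>

lemma strongly_regular_imp_ord_pos:
  assumes sr: "strongly_regular_ring TYPE('a)" and g: "g \<in> carrier G"
  shows "ord g > 0"
proof (rule ccontr)
  assume "\<not> ord g > 0"
  then have inj: "inj (\<lambda>i::nat. g [^] i)"
    using ord_eq_0_imp_inj_pow[OF g] by simp
  obtain s where s: "1 - u g = s * (1 - u g) * (1 - u g)"
    using sr unfolding strongly_regular_ring_def by blast
  define w where "w = 1 - s * (1 - u g)"
  have "w * (1 - u g) = 0"
    using s by (simp add: w_def left_diff_distrib)
  then have wu: "w * u g = w"
    by (simp add: right_diff_distrib)
  have w_power: "w * u g ^ k = w" for k
    by (induction k) (simp_all add: wu flip: mult.assoc)
  have "support w = {}"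
  proof (rule ccontr)
    assume "support w \<noteq> {}"
    then obtain h where h: "h \<in> support w"
      by blast
    then have "h \<otimes> g [^] k \<in> support w" for k :: nat
      using support_mult_power_u[OF g, of w k] w_power by auto
    then have "range (\<lambda>k::nat. h \<otimes> g [^] k) \<subseteq> support w"
      by blast
    moreover have "inj (\<lambda>k::nat. h \<otimes> g [^] k)"
      using h g inj by (auto simp: inj_def support_def)
    ultimately show False
      using finite_support[of w] finite_imageD finite_subset infinite_UNIV_nat by metis
  qed
  then have "s * (1 - u g) = 1"
    using support_eq_empty_imp_eq_0[of w] by (simp add: w_def)
  \<comment> \<open>one more than the number of basis vectors that the right-hand side can carry\<close>
  define k where "k = Suc (2 * card (support s))"
  have "(\<Sum>i<k. u g ^ i) = s * (1 - u g) * (\<Sum>i<k. u g ^ i)"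
    by (simp add: \<open>s * (1 - u g) = 1\<close>)
  also have "\<dots> = s * (1 - u g ^ k)"
    by (simp only: mult.assoc one_minus_times_geometric_sum)
  also have "\<dots> = s - s * u g ^ k"
    by (simp add: right_diff_distrib)
  finally have "support (\<Sum>i<k. u g ^ i) \<subseteq> support s \<union> support (s * u g ^ k)"
    using support_diff_subset by simp
  moreover have "support (\<Sum>i<k. u g ^ i) = (\<lambda>i. g [^] i) ` {..<k}"
    using support_geometric_sum[OF g, of 1 k] inj inj_on_subset by fastforce
  moreover have "card ((\<lambda>i. g [^] i) ` {..<k}) = k"
    using inj by (subst card_image) (auto intro: inj_on_subset)
  ultimately have "k \<le> card (support s \<union> support (s * u g ^ k))"
    by (metis card_mono finite_UnI finite_support)
  also have "\<dots> \<le> card (support s) + card (support (s * u g ^ k))"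
    by (rule card_Un_le)
  also have "card (support (s * u g ^ k)) \<le> card (support s)"
    by (simp add: support_mult_power_u g card_image_le finite_support)
  finally show False
    by (simp add: k_def)
qed

text \<open>
  For \<open>v = c u g\<close> with \<open>v\<^sup>m = 1\<close>, \<open>m\<close> the order of \<open>g\<close>, the norm element
  \<open>e = \<Sum>i<m. v\<^sup>i\<close> satisfies \<open>v e = e\<close> and so \<open>e\<^sup>2 = m e\<close>. If \<open>m\<close> vanished in the field, \<open>e\<close>
  would be a nonzero element of square zero.
\<close>

lemma reduced_imp_ord_invertible:
  assumes red: "reduced_ring TYPE('a)" and g: "g \<in> carrier G"
    and c: "c \<noteq> 0" and root: "(c *s u g) ^ ord g = 1"
    and "ord g > 0"
  shows "of_nat (ord g) \<noteq> (0::'k)"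
proof
  assume char: "of_nat (ord g) = (0::'k)"
  define v where "v = c *s u g"
  define e where "e = (\<Sum>i<ord g. v ^ i)"
  have "(1 - v) * e = 1 - v ^ ord g"
    unfolding e_def by (rule one_minus_times_geometric_sum)
  then have "v * e = e"
    using root by (simp add: v_def left_diff_distrib)
  then have "v ^ i * e = e" for i
    by (induction i) (simp_all add: mult.assoc)
  then have "e * e = of_nat (ord g) * e"
    by (subst (1) e_def) (simp add: sum_distrib_right)
  also have "\<dots> = of_nat (ord g) *s e"
  proof -
    have "of_nat k * x = of_nat k *s x" for k x
      by (induction k) (simp_all add: algebra_simps)
    then show ?thesis .
  qed
  finally have "e * e = 0"
    using char by simp
  then have "e = 0"
    by (rule reduced_ringD[OF red])
  moreover have "inj_on (\<lambda>i. g [^] i) {..<ord g}"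
    using ord_inj[OF g] by (rule inj_on_subset) auto
  then have "support e = (\<lambda>i. g [^] i) ` {..<ord g}"
    unfolding e_def v_def by (rule support_geometric_sum[OF g c])
  ultimately show False
    using \<open>ord g > 0\<close> by auto
qed

text \<open>
  Commutation of basis vectors encodes commutation in the group and symmetry of the factor system
  at once, which is why both conditions come out of the centrality of every \<open>u g\<close>.
\<close>

lemma commute_u_iff:
  assumes "g \<in> carrier G" "h \<in> carrier G"
  shows "u g * u h = u h * u g \<longleftrightarrow> g \<otimes> h = h \<otimes> g \<and> \<rho> g h = \<rho> h g"
proof
  assume "u g * u h = u h * u g"
  then have "coeff_u (\<rho> g h *s u (g \<otimes> h)) (g \<otimes> h) = coeff_u (\<rho> h g *s u (h \<otimes> g)) (g \<otimes> h)"
    using assms by (simp add: u_mult)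
  then show "g \<otimes> h = h \<otimes> g \<and> \<rho> g h = \<rho> h g"
    using assms factor_nonzero[OF assms] by (auto simp: coeff_u_scale coeff_u_u split: if_splits)
qed (simp add: assms u_mult)

lemma commutative_if_symmetric:
  fixes x y :: 'a
  assumes "comm_group G" "symmetric_factor_system G \<rho>"
  shows "x * y = y * x"
proof -
  have "u g * u h = u h * u g" if "g \<in> carrier G" "h \<in> carrier G" for g h
    using that assms comm_groupE(4)[OF assms(1)]
    by (simp add: commute_u_iff symmetric_factor_system_def)
  then have "y * u g = u g * y" if "g \<in> carrier G" for g
    using that by (intro commute_with_span[OF in_span_u[of y]]) blast
  then show ?thesis
    by (intro commute_with_span[OF in_span_u[of x]]) fastforce
qed

end

text \<open>
  The condition that orders are invertible enters both implications of the theorem through this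
  fact: some power of \<open>u g\<close> with invertible exponent is a nonzero scalar.
\<close>

lemma u_in_span_idempotents:
  fixes scale :: "'k::alg_closed_field \<Rightarrow> 'a::ring_1 \<Rightarrow> 'a"
  assumes tga: "twisted_group_algebra G scale \<rho> u"
    and g: "g \<in> carrier G"
    and inv: "of_nat (group.ord G g) \<noteq> (0::'k)"
  shows "u g \<in> module.span scale {e. e * e = e}"
proof -
  interpret twisted_group_algebra G scale \<rho> u by (fact tga)
  obtain d where "d \<noteq> 0" "scale 1 (u g) ^ ord g = scale d (u (g [^]\<^bsub>G\<^esub> ord g))"
    using power_scaled_u[OF g, of 1] by auto
  then have "u g ^ ord g = scale d 1"
    using g by (simp add: u_one)
  then show ?thesis
    using \<open>d \<noteq> 0\<close> inv by (rule root_of_scalar_in_span_idempotents[OF unital_algebra_axioms])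
qed

theorem theorem4:
  fixes n :: nat
    and G :: "('g, 'm) monoid_scheme"
    and scale :: "'k::alg_closed_field \<Rightarrow> 'a::ring_1 \<Rightarrow> 'a"
    and \<rho> :: "'g \<Rightarrow> 'g \<Rightarrow> 'k"
    and u :: "'g \<Rightarrow> 'a"
  assumes "n \<ge> 2"
    and "twisted_group_algebra G scale \<rho> u"
  shows "n_weakly_regular n TYPE('a) \<longleftrightarrow>
           (comm_group G \<and> torsion_group G) \<and>
           (\<forall>g\<in>carrier G. of_nat (group.ord G g) \<noteq> (0::'k)) \<and>
           symmetric_factor_system G \<rho>"
proof -
  interpret twisted_group_algebra G scale \<rho> u by (fact assms(2))
  show ?thesis
  proof (intro iffI conjI; (elim conjE)?)
    assume "n_weakly_regular n TYPE('a)"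
    then have sr: "strongly_regular_ring TYPE('a)"
      using \<open>n \<ge> 2\<close> by (rule n_weakly_regular_imp_strongly_regular)
    then have red: "reduced_ring TYPE('a)"
      by (rule strongly_regular_imp_reduced)
    note ord_pos = strongly_regular_imp_ord_pos[OF sr]
    then show "torsion_group G"
      unfolding torsion_group_def using pow_ord_eq_1 is_group by blast
    show ord: "\<forall>g\<in>carrier G. of_nat (ord g) \<noteq> (0::'k)"
    proof
      fix g
      assume g: "g \<in> carrier G"
      obtain d where d: "d \<noteq> 0" "scale 1 (u g) ^ ord g = scale d (u (g [^]\<^bsub>G\<^esub> ord g))"
        using power_scaled_u[OF g, of 1] by auto
      \<comment> \<open>\<open>(u g)\<^sup>m\<close> is the scalar \<open>d\<close>, so a root of \<open>1 / d\<close> normalises \<open>u g\<close> to a root of \<open>1\<close>\<close>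
      obtain c where c: "c ^ ord g = inverse d"
        using nth_root_exists ord_pos[OF g] by blast
      have "scale c (u g) ^ k = scale (c ^ k) (u g ^ k)" for k
        by (induction k) (simp_all add: scale_mult_left scale_mult_right mult.commute)
      then have "scale c (u g) ^ ord g = 1"
        using c d g by (simp add: u_one)
      moreover have "c \<noteq> 0"
        using c d ord_pos[OF g] by (auto simp: zero_power)
      ultimately show "of_nat (ord g) \<noteq> (0::'k)"
        using reduced_imp_ord_invertible[OF red g] ord_pos[OF g] by blast
    qed
    have "u g * u h = u h * u g" if "g \<in> carrier G" for g h
    proof (rule commute_with_span)
      show "u g \<in> span {e. e * e = e}"
        using that ord by (intro u_in_span_idempotents[OF assms(2)]) auto
    qed (auto intro: reduced_ring_idempotent_central[OF red])
    then have comm: "g \<otimes>\<^bsub>G\<^esub> h = h \<otimes>\<^bsub>G\<^esub> g \<and> \<rho> g h = \<rho> h g" if "g \<in> carrier G" "h \<in> carrier G" for g h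
      using that by (simp add: commute_u_iff[symmetric])
    then show "comm_group G" "symmetric_factor_system G \<rho>"
      by (auto intro!: group_comm_groupI simp: symmetric_factor_system_def)
  next
    assume "comm_group G" and symmetric: "symmetric_factor_system G \<rho>"
      and ord: "\<forall>g\<in>carrier G. of_nat (ord g) \<noteq> (0::'k)"
    have "x \<in> span {e. e * e = e \<and> (\<forall>y. e * y = y * e)}" for x
    proof -
      have "u ` carrier G \<subseteq> span {e. e * e = e}"
        using ord u_in_span_idempotents[OF assms(2)] by blast
      then have "span (u ` carrier G) \<subseteq> span {e. e * e = e}"
        by (simp add: span_minimal)
      moreover have "{e. e * e = e \<and> (\<forall>y. e * y = y * e)} = {e::'a. e * e = e}"
        using commutative_if_symmetric[OF \<open>comm_group G\<close> symmetric] by blast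
      ultimately show ?thesis
        using in_span_u by auto
    qed
    then have "strongly_regular_ring TYPE('a)"
      unfolding strongly_regular_ring_def using span_central_idempotents_regular by blast
    then show "n_weakly_regular n TYPE('a)"
      using \<open>n \<ge> 2\<close> by (intro strongly_regular_imp_n_weakly_regular) auto
  qed
qed
end
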